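(* Let $\{\mathcal{G}_j : j \in J\}$ be a Parseval HS-frame for $\mathbb{H}$ with respect to $\mathbb{K}$. Then for all $K \subset J$ and all $f \in \mathbb{H}$, \[ \sum_{j \in K}\Vert \mathcal{G}_j(f) \Vert_2^2 + \bigg\Vert \sum_{j \in K^c} \mathcal{G}_j^* \mathcal{G}_j f \bigg\Vert^2 \geq \frac{3}{4} \Vert f \Vert^2 . \]
   Context: $\mathbb{H}$ and $\mathbb{K}$ are complex Hilbert spaces, $J$ is a countable index set, and $K^c = J \setminus K$ for $K \subset J$. $C_2 \subseteq \mathcal{L}(\mathbb{K})$ denotes the Hilbert-Schmidt class of operators on $\mathbb{K}$, a Hilbert space with inner product $[T,S]_\tau = \tau(S^*T)$ ($\tau$ the usual trace) and norm $\Vert T\Vert_2 = [T,T]_\tau^{1/2}$. A family $\{\mathcal{G}_j : j \in J\}$ of bounded linear operators from $\mathbb{H}$ to $C_2 \subseteq \mathcal{L}(\mathbb{K})$ is a Hilbert-Schmidt frame (HS-frame) for $\mathbb{H}$ with respect to $\mathbb{K}$ if there are constants $A,B>0$ such that $A\Vert f\Vert^2 \le \sum_{j\in J}\Vert \mathcal{G}_j(f)\Vert_2^2 \le B\Vert f\Vert^2$ for all $f\in\mathbb{H}$. It is a Parseval HS-frame if this holds with $A=B=1$. $\mathcal{G}_j^*: C_2 \to \mathbb{H}$ is the adjoint of $\mathcal{G}_j$. Series in $\mathbb{H}$ are understood as unconditionally convergent in norm. *)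

theory Defs
  imports "HOL-Analysis.Analysis"
begin

section \<open>Complex Hilbert spaces\<close>

text \<open>The inner product is linear in its first argument. The norm, its topology and
  completeness are those of the library class \<^class>\<open>banach\<close>.\<close>

class chilbert_space = banach +
  fixes scaleC :: "complex \<Rightarrow> 'a \<Rightarrow> 'a" (infixr "*\<^sub>C" 75)
    and cinner :: "'a \<Rightarrow> 'a \<Rightarrow> complex"
  assumes scaleC_add_right: "a *\<^sub>C (x + y) = a *\<^sub>C x + a *\<^sub>C y"
    and scaleC_add_left: "(a + b) *\<^sub>C x = a *\<^sub>C x + b *\<^sub>C x"
    and scaleC_scaleC: "a *\<^sub>C b *\<^sub>C x = (a * b) *\<^sub>C x"
    and scaleC_one: "1 *\<^sub>C x = x"
    and scaleR_scaleC: "r *\<^sub>R x = complex_of_real r *\<^sub>C x"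
    and cinner_add_left: "cinner (x + y) z = cinner x z + cinner y z"
    and cinner_scaleC_left: "cinner (a *\<^sub>C x) y = a * cinner x y"
    and cinner_commute: "cinner x y = cnj (cinner y x)"
    and cinner_ge_zero: "0 \<le> Re (cinner x x)"
    and cinner_eq_zero_iff: "cinner x x = 0 \<longleftrightarrow> x = 0"
    and norm_eq_sqrt_cinner: "norm x = sqrt (Re (cinner x x))"

definition clinear :: "('a::chilbert_space \<Rightarrow> 'b::chilbert_space) \<Rightarrow> bool" where
  "clinear T \<longleftrightarrow> (\<forall>x y. T (x + y) = T x + T y) \<and> (\<forall>a x. T (a *\<^sub>C x) = a *\<^sub>C T x)"

definition bounded_clinear :: "('a::chilbert_space \<Rightarrow> 'b::chilbert_space) \<Rightarrow> bool" where
  "bounded_clinear T \<longleftrightarrow> clinear T \<and> (\<exists>B. \<forall>x. norm (T x) \<le> B * norm x)"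

text \<open>For bounded linear \<open>T\<close>, the vector \<open>cadjoint T y\<close> exists and is unique by the Riesz
  representation theorem.\<close>

definition cadjoint :: "('a::chilbert_space \<Rightarrow> 'b::chilbert_space) \<Rightarrow> 'b \<Rightarrow> 'a" where
  "cadjoint T y = (THE z. \<forall>x. cinner (T x) y = cinner x z)"

text \<open>An orthonormal basis is a maximal orthonormal set.\<close>

definition orthonormal :: "'a::chilbert_space set \<Rightarrow> bool" where
  "orthonormal E \<longleftrightarrow> (\<forall>x\<in>E. \<forall>y\<in>E. cinner x y = (if x = y then 1 else 0))"

definition is_onb :: "'a::chilbert_space set \<Rightarrow> bool" where
  "is_onb E \<longleftrightarrow> orthonormal E \<and> (\<forall>F. orthonormal F \<and> E \<subseteq> F \<longrightarrow> F = E)"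

lemma is_onb_exists: "\<exists>E::'a::chilbert_space set. is_onb E"
proof -
  have "\<exists>M\<in>Collect orthonormal. \<forall>X\<in>Collect orthonormal. M \<subseteq> X \<longrightarrow> X = (M::'a set)"
  proof (rule subset_Zorn_nonempty)
    have "orthonormal ({}::'a set)"
      by (simp add: orthonormal_def)
    then show "Collect orthonormal \<noteq> ({}::'a set set)"
      by blast
  next
    fix \<C> :: "'a set set"
    assume "\<C> \<noteq> {}" and chain: "subset.chain (Collect orthonormal) \<C>"
    have "cinner x y = (if x = y then 1 else 0)" if xy: "x \<in> \<Union>\<C>" "y \<in> \<Union>\<C>" for x y
    proof -
      obtain X Y where XY: "X \<in> \<C>" "x \<in> X" "Y \<in> \<C>" "y \<in> Y"
        using xy by blast
      moreover have "X \<subseteq> Y \<or> Y \<subseteq> X" "orthonormal X" "orthonormal Y"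
        using XY chain by (auto simp: subset_chain_def)
      ultimately show ?thesis
        unfolding orthonormal_def by blast
    qed
    then show "\<Union>\<C> \<in> Collect orthonormal"
      by (simp add: orthonormal_def)
  qed
  then show ?thesis
    unfolding is_onb_def by blast
qed

text \<open>The Hilbert-Schmidt class and the trace do not depend on the orthonormal basis with
  which they are computed, so one basis is chosen once and for all.\<close>

definition some_onb :: "'a::chilbert_space set" where
  "some_onb = (SOME E. is_onb E)"

lemma is_onb_some_onb: "is_onb (some_onb :: 'a::chilbert_space set)"
  unfolding some_onb_def by (rule someI_ex[OF is_onb_exists])


section \<open>The Hilbert-Schmidt class\<close>

definition hs_class :: "('k::chilbert_space \<Rightarrow> 'k) set" where
  "hs_class = {T. bounded_clinear T \<and> (\<lambda>e. (norm (T e))\<^sup>2) summable_on some_onb}"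

definition op_trace :: "('k::chilbert_space \<Rightarrow> 'k) \<Rightarrow> complex" where
  "op_trace A = (\<Sum>\<^sub>\<infinity>e\<in>some_onb. cinner (A e) e)"

definition hs_inner :: "('k::chilbert_space \<Rightarrow> 'k) \<Rightarrow> ('k \<Rightarrow> 'k) \<Rightarrow> complex" where
  "hs_inner T S = op_trace (cadjoint S \<circ> T)"

definition hs_norm :: "('k::chilbert_space \<Rightarrow> 'k) \<Rightarrow> real" where
  "hs_norm T = sqrt (Re (hs_inner T T))"

text \<open>Bounded linear operators from a Hilbert space into the Hilbert-Schmidt class, with the
  pointwise vector space structure and \<open>hs_norm\<close> on the latter.\<close>

definition hs_bounded_clinear :: "('h::chilbert_space \<Rightarrow> 'k::chilbert_space \<Rightarrow> 'k) \<Rightarrow> bool" where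
  "hs_bounded_clinear G \<longleftrightarrow>
     (\<forall>f. G f \<in> hs_class) \<and>
     (\<forall>f g. G (f + g) = (\<lambda>x. G f x + G g x)) \<and>
     (\<forall>a f. G (a *\<^sub>C f) = (\<lambda>x. a *\<^sub>C G f x)) \<and>
     (\<exists>B. \<forall>f. hs_norm (G f) \<le> B * norm f)"

text \<open>The adjoint is meaningful on \<open>hs_class\<close> only, again by the Riesz representation theorem.\<close>

definition hs_adjoint :: "('h::chilbert_space \<Rightarrow> 'k::chilbert_space \<Rightarrow> 'k) \<Rightarrow> ('k \<Rightarrow> 'k) \<Rightarrow> 'h" where
  "hs_adjoint G T = (THE h. \<forall>f. hs_inner (G f) T = cinner f h)"


section \<open>Hilbert-Schmidt frames\<close>

definition hs_frame_bounds ::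
  "real \<Rightarrow> real \<Rightarrow> 'i set \<Rightarrow> ('i \<Rightarrow> 'h::chilbert_space \<Rightarrow> 'k::chilbert_space \<Rightarrow> 'k) \<Rightarrow> bool" where
  "hs_frame_bounds A B J G \<longleftrightarrow>
     (\<forall>j\<in>J. hs_bounded_clinear (G j)) \<and> 0 < A \<and> 0 < B \<and>
     (\<forall>f. (\<lambda>j. (hs_norm (G j f))\<^sup>2) summable_on J \<and>
          A * (norm f)\<^sup>2 \<le> (\<Sum>\<^sub>\<infinity>j\<in>J. (hs_norm (G j f))\<^sup>2) \<and>
          (\<Sum>\<^sub>\<infinity>j\<in>J. (hs_norm (G j f))\<^sup>2) \<le> B * (norm f)\<^sup>2)"

definition hs_frame ::
  "'i set \<Rightarrow> ('i \<Rightarrow> 'h::chilbert_space \<Rightarrow> 'k::chilbert_space \<Rightarrow> 'k) \<Rightarrow> bool" where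
  "hs_frame J G \<longleftrightarrow> (\<exists>A B. hs_frame_bounds A B J G)"

definition parseval_hs_frame ::
  "'i set \<Rightarrow> ('i \<Rightarrow> 'h::chilbert_space \<Rightarrow> 'k::chilbert_space \<Rightarrow> 'k) \<Rightarrow> bool" where
  "parseval_hs_frame J G \<longleftrightarrow> hs_frame_bounds 1 1 J G"

end

theory Submission
  imports Defs
begin

text \<open>
  Write \<open>a\<close> and \<open>b\<close> for the sums of \<open>G\<^sub>j\<^sup>* G\<^sub>j f\<close> over \<open>K\<close> and over \<open>J - K\<close>. Both series converge,
  as the square norm of a finite partial sum is at most the corresponding partial sum of
  \<open>\<parallel>G\<^sub>j f\<parallel>\<^sub>2\<^sup>2\<close>; the same bound and \<open>\<langle>f, a + b\<rangle> = \<parallel>f\<parallel>\<^sup>2\<close> give \<open>\<parallel>f - (a + b)\<parallel>\<^sup>2 \<le> 0\<close>, so \<open>a + b = f\<close>.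
  The left-hand side is therefore \<open>Re \<langle>f, f - b\<rangle> + \<parallel>b\<parallel>\<^sup>2 = \<parallel>b - f/2\<parallel>\<^sup>2 + 3/4 \<parallel>f\<parallel>\<^sup>2\<close>.
\<close>

section \<open>Inner products\<close>

lemma cinner_add_right: "cinner x (y + z) = cinner x y + cinner x z"
  by (metis cinner_add_left cinner_commute complex_cnj_add)

lemma cinner_scaleC_right: "cinner x (a *\<^sub>C y) = cnj a * cinner x y"
  by (metis cinner_commute cinner_scaleC_left complex_cnj_mult)

lemma cinner_scaleR_left: "cinner (r *\<^sub>R x) y = r * cinner x y"
  by (simp add: scaleR_scaleC cinner_scaleC_left)

lemma cinner_scaleR_right: "cinner x (r *\<^sub>R y) = r * cinner x y"
  by (simp add: scaleR_scaleC cinner_scaleC_right)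

lemma cinner_minus_left: "cinner (- x) y = - cinner x y"
  using cinner_scaleR_left[of "-1" x y] by simp

lemma cinner_minus_right: "cinner x (- y) = - cinner x y"
  using cinner_scaleR_right[of x "-1" y] by simp

lemma cinner_diff_left: "cinner (x - y) z = cinner x z - cinner y z"
  using cinner_add_left[of x "- y" z] by (simp add: cinner_minus_left)

lemma cinner_diff_right: "cinner x (y - z) = cinner x y - cinner x z"
  using cinner_add_right[of x y "- z"] by (simp add: cinner_minus_right)

lemma Re_cinner_commute: "Re (cinner x y) = Re (cinner y x)"
  by (subst cinner_commute) simp

lemma power2_norm_eq_cinner: "(norm x)\<^sup>2 = Re (cinner x x)"
  by (simp add: norm_eq_sqrt_cinner cinner_ge_zero)

lemma cinner_self: "cinner x x = complex_of_real ((norm x)\<^sup>2)"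
proof -
  have "Im (cinner x x) = 0"
    using cinner_commute[of x x] by (metis complex_cnj_cancel_iff complex_is_Real_iff Reals_cnj_iff)
  then show ?thesis
    by (simp add: complex_eq_iff power2_norm_eq_cinner)
qed

lemma power2_norm_add: "(norm (x + y))\<^sup>2 = (norm x)\<^sup>2 + 2 * Re (cinner x y) + (norm y)\<^sup>2"
  by (simp add: power2_norm_eq_cinner cinner_add_left cinner_add_right Re_cinner_commute[of y x])

lemma power2_norm_diff: "(norm (x - y))\<^sup>2 = (norm x)\<^sup>2 - 2 * Re (cinner x y) + (norm y)\<^sup>2"
  by (simp add: power2_norm_eq_cinner cinner_diff_left cinner_diff_right Re_cinner_commute[of y x])

lemma norm_scaleC: "norm (a *\<^sub>C x) = cmod a * norm x"
proof (rule power2_eq_imp_eq)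
  have "cinner (a *\<^sub>C x) (a *\<^sub>C x) = (a * cnj a) * cinner x x"
    by (simp add: cinner_scaleC_left cinner_scaleC_right)
  also have "\<dots> = complex_of_real ((cmod a * norm x)\<^sup>2)"
    by (simp add: cinner_self power_mult_distrib flip: complex_norm_square)
  finally show "(norm (a *\<^sub>C x))\<^sup>2 = (cmod a * norm x)\<^sup>2"
    by (simp add: power2_norm_eq_cinner)
qed auto

text \<open>Cauchy-Schwarz: the square norm of
  \<open>(norm y)\<^sup>2 *\<^sub>R x - c *\<^sub>C y\<close> with \<open>c = cinner x y\<close> is
  nonnegative. Scaling \<open>x\<close> instead of dividing \<open>c\<close> leaves a common factor
  \<open>(norm y)\<^sup>2\<close> to cancel.\<close>

lemma norm_cinner_le: "cmod (cinner x y) \<le> norm x * norm y"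
proof (cases "y = 0")
  case True
  then show ?thesis
    using cinner_scaleR_right[of x 0 y] by simp
next
  case False
  define c where "c = cinner x y"
  have "Re (cinner x (c *\<^sub>C y)) = (cmod c)\<^sup>2"
    by (metis cinner_scaleC_right c_def complex_norm_square mult.commute Re_complex_of_real)
  then have "0 \<le> (norm y)\<^sup>2 * ((norm x)\<^sup>2 * (norm y)\<^sup>2 - (cmod c)\<^sup>2)"
    using zero_le_power2[of "norm ((norm y)\<^sup>2 *\<^sub>R x - c *\<^sub>C y)"]
    unfolding power2_norm_diff
    by (simp add: cinner_scaleR_left norm_scaleC power_mult_distrib algebra_simps power2_eq_square)
  then have "(cmod c)\<^sup>2 \<le> (norm x * norm y)\<^sup>2"
    using False by (simp add: zero_le_mult_iff power_mult_distrib)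
  then show ?thesis
    unfolding c_def by (rule power2_le_imp_le) simp
qed

lemma bounded_linear_Re_cinner_right: "bounded_linear (\<lambda>y. Re (cinner x y))"
proof (rule bounded_linear_intro)
  show "norm (Re (cinner x y)) \<le> norm y * norm x" for y
    using abs_Re_le_cmod[of "cinner x y"] norm_cinner_le[of x y] by (simp add: mult.commute)
qed (simp_all add: cinner_add_right cinner_scaleR_right)

text \<open>Testing against \<open>y - z\<close> suffices. This is the uniqueness that evaluates the
  \<open>THE\<close> in both adjoints.\<close>

lemma cinner_ext:
  assumes "\<And>x. cinner x y = cinner x z"
  shows "y = z"
proof -
  have "cinner (y - z) (y - z) = 0"
    using assms[of "y - z"] by (simp add: cinner_diff_right)
  then show ?thesis
    by (simp add: cinner_eq_zero_iff)
qed


section \<open>Riesz representation\<close>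

text \<open>First-order condition at a minimum: for small \<open>t\<close> of sign opposite to
  \<open>b\<close> the linear term would dominate.\<close>

lemma quadratic_nonneg_imp_linear_zero:
  fixes a b :: real
  assumes "\<And>t. 0 \<le> t\<^sup>2 * a + t * b"
  shows "b = 0"
proof (rule ccontr)
  assume "b \<noteq> 0"
  \<comment> \<open>Chosen so that \<open>s * a < 1\<close> whatever the sign of \<open>a\<close>;
    then \<open>t = - s * b\<close> makes the quadratic negative.\<close>
  define s where "s = 1 / (\<bar>a\<bar> + 1)"
  have "s > 0" "s * a < 1"
    by (auto simp: s_def field_simps)
  have "(- s * b)\<^sup>2 * a + (- s * b) * b = s * b\<^sup>2 * (s * a - 1)"
    by (simp add: power2_eq_square algebra_simps)
  also have "\<dots> < 0"
    using \<open>s > 0\<close> \<open>s * a < 1\<close> \<open>b \<noteq> 0\<close> by (simp add: mult_pos_neg)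
  finally show False
    using assms[of "- s * b"] by simp
qed

text \<open>The representing vector is the minimiser of \<open>\<parallel>x\<parallel>\<^sup>2 - 2 Re (\<phi> x)\<close>; minimising sequences are
  Cauchy by the parallelogram law.\<close>

lemma riesz_representation:
  fixes \<phi> :: "'a::chilbert_space \<Rightarrow> complex"
  assumes add: "\<And>x y. \<phi> (x + y) = \<phi> x + \<phi> y"
    and scale: "\<And>a x. \<phi> (a *\<^sub>C x) = a * \<phi> x"
    and bound: "\<And>x. cmod (\<phi> x) \<le> B * norm x"
  obtains z where "\<And>x. \<phi> x = cinner x z"
proof -
  define Q where "Q x = (norm x)\<^sup>2 - 2 * Re (\<phi> x)" for x
  have scaleR: "\<phi> (r *\<^sub>R x) = r * \<phi> x" for r x
    by (simp add: scaleR_scaleC scale)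
  have bl: "bounded_linear (\<lambda>x. Re (\<phi> x))"
  proof (rule bounded_linear_intro)
    show "norm (Re (\<phi> x)) \<le> norm x * B" for x
      using abs_Re_le_cmod[of "\<phi> x"] bound[of x] by (simp add: mult.commute)
  qed (simp_all add: add scaleR)
  \<comment> \<open>Completing the square in \<open>norm x\<close> bounds \<open>Q\<close> below, so
    its infimum is meaningful.\<close>
  have Q_ge: "Q x \<ge> - B\<^sup>2" for x
  proof -
    have "Re (\<phi> x) \<le> B * norm x"
      using bound[of x] complex_Re_le_cmod[of "\<phi> x"] by linarith
    then show ?thesis
      using zero_le_power2[of "norm x - B"] by (simp add: Q_def power2_diff mult.commute)
  qed
  define m where "m = (INF x. Q x)"
  have bdd: "bdd_below (range Q)"
    using Q_ge by (auto simp: bdd_below_def)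
  have m_le: "m \<le> Q x" for x
    unfolding m_def using bdd by (rule cINF_lower) simp
  have "\<exists>x. Q x < m + 1 / real (Suc n)" for n
    using cINF_less_iff[OF _ bdd, of "m + 1 / real (Suc n)"] by (auto simp: m_def)
  then obtain X where X: "Q (X n) < m + 1 / real (Suc n)" for n
    by metis
  \<comment> \<open>In this combination the contributions of \<open>\<phi>\<close> cancel, leaving
    the parallelogram law.\<close>
  have para: "(norm (x - y))\<^sup>2 = 2 * Q x + 2 * Q y - 4 * Q ((1/2) *\<^sub>R (x + y))" for x y
    by (simp add: Q_def power2_norm_diff power2_norm_add add scaleR power_divide
        cinner_scaleR_left cinner_scaleR_right field_simps)
  have "Cauchy X"
  proof (rule CauchyI)
    fix e :: real
    assume "0 < e"
    obtain N where N: "4 / e\<^sup>2 < real N"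
      using reals_Archimedean2 by blast
    \<comment> \<open>Both values of \<open>Q\<close> lie less than \<open>1 / N\<close> above
      \<open>m\<close> and the midpoint value is at least \<open>m\<close>, so \<open>para\<close>
      gives a square distance below \<open>4 / N\<close>.\<close>
    have "norm (X i - X j) < e" if "i \<ge> N" "j \<ge> N" for i j
    proof -
      have N0: "0 < real N"
        using N by (rule le_less_trans[rotated]) simp
      have "1 / real (Suc i) \<le> 1 / real N" "1 / real (Suc j) \<le> 1 / real N"
        using that N0 by (auto intro!: divide_left_mono)
      then have "(norm (X i - X j))\<^sup>2 < 4 / real N"
        using X[of i] X[of j] m_le[of "(1/2) *\<^sub>R (X i + X j)"] unfolding para by linarith
      also have "\<dots> < e\<^sup>2"
        using N N0 \<open>0 < e\<close> by (simp add: field_simps)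
      finally show ?thesis
        using \<open>0 < e\<close> by (simp add: power_less_imp_less_base)
    qed
    then show "\<exists>N. \<forall>i\<ge>N. \<forall>j\<ge>N. norm (X i - X j) < e"
      by blast
  qed
  then obtain z where z: "X \<longlonglongrightarrow> z"
    using Cauchy_convergent convergent_def by blast
  have "(\<lambda>n. Q (X n)) \<longlonglongrightarrow> Q z"
    unfolding Q_def by (intro tendsto_intros z bounded_linear.tendsto[OF bl])
  moreover have "(\<lambda>n. m + 1 / real (Suc n)) \<longlonglongrightarrow> m + 0"
    by (intro tendsto_intros LIMSEQ_Suc[OF lim_1_over_n])
  ultimately have "Q z \<le> m"
    using X by (auto intro: LIMSEQ_le less_imp_le)
  then have min: "Q z \<le> Q x" for x
    using m_le[of x] by linarith
  \<comment> \<open>Minimality of \<open>z\<close> along the real line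
    \<open>z + t *\<^sub>R x\<close> kills the coefficient of \<open>t\<close>.\<close>
  have Re_eq: "Re (\<phi> x) = Re (cinner x z)" for x
  proof -
    have "0 \<le> t\<^sup>2 * (norm x)\<^sup>2 + t * (2 * (Re (cinner x z) - Re (\<phi> x)))" for t
      using min[of "z + t *\<^sub>R x"]
      by (simp add: Q_def power2_norm_add add scaleR cinner_scaleR_right power_mult_distrib
          Re_cinner_commute[of z x] algebra_simps)
    then show ?thesis
      using quadratic_nonneg_imp_linear_zero by fastforce
  qed
  \<comment> \<open>Replacing \<open>x\<close> by \<open>\<i> *\<^sub>C x\<close> turns imaginary
    parts into real ones, up to sign.\<close>
  have "\<phi> x = cinner x z" for x
    using Re_eq[of x] Re_eq[of "\<i> *\<^sub>C x"] by (simp add: complex_eq_iff scale cinner_scaleC_left)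
  then show ?thesis
    by (rule that)
qed

lemma cinner_cadjoint:
  assumes "bounded_clinear T"
  shows "cinner (T x) y = cinner x (cadjoint T y)"
proof -
  obtain B where B: "\<And>x. norm (T x) \<le> B * norm x"
    using assms by (auto simp: bounded_clinear_def)
  have "cmod (cinner (T x) y) \<le> (B * norm y) * norm x" for x
    using norm_cinner_le[of "T x" y] mult_right_mono[OF B[of x] norm_ge_zero[of y]]
    by (simp add: mult_ac)
  moreover have "cinner (T (u + v)) y = cinner (T u) y + cinner (T v) y"
    and "cinner (T (a *\<^sub>C v)) y = a * cinner (T v) y" for a u v
    using assms
    by (simp_all add: bounded_clinear_def clinear_def cinner_add_left cinner_scaleC_left)
  ultimately obtain z where z: "\<And>x. cinner (T x) y = cinner x z"
    using riesz_representation[of "\<lambda>x. cinner (T x) y"] by blast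
  then have "cadjoint T y = z"
    unfolding cadjoint_def by (intro the_equality) (auto intro: cinner_ext)
  with z show ?thesis
    by simp
qed


section \<open>The Hilbert-Schmidt inner product\<close>

text \<open>The finite Cauchy-Schwarz inequality, with partial sums of squares enlarged to full
  sums. The bound is uniform in \<open>F\<close>, which yields both summability and the infinite
  inequality.\<close>

lemma sum_mult_le_sqrt_infsum:
  fixes f g :: "'a \<Rightarrow> real"
  assumes "(\<lambda>x. (f x)\<^sup>2) summable_on A" "(\<lambda>x. (g x)\<^sup>2) summable_on A" "finite F" "F \<subseteq> A"
  shows "(\<Sum>x\<in>F. \<bar>f x * g x\<bar>) \<le> sqrt (\<Sum>\<^sub>\<infinity>x\<in>A. (f x)\<^sup>2) * sqrt (\<Sum>\<^sub>\<infinity>x\<in>A. (g x)\<^sup>2)"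
proof -
  have "(\<Sum>x\<in>F. \<bar>f x * g x\<bar>) \<le> L2_set f F * L2_set g F"
    using L2_set_mult_ineq[of f g F] by (simp add: abs_mult)
  also have "\<dots> \<le> sqrt (\<Sum>\<^sub>\<infinity>x\<in>A. (f x)\<^sup>2) * sqrt (\<Sum>\<^sub>\<infinity>x\<in>A. (g x)\<^sup>2)"
    unfolding L2_set_def using assms
    by (intro mult_mono real_sqrt_le_mono finite_sum_le_infsum) (auto intro: sum_nonneg infsum_nonneg)
  finally show ?thesis .
qed

lemma cauchy_schwarz_infsum:
  fixes f g :: "'a \<Rightarrow> real"
  assumes "(\<lambda>x. (f x)\<^sup>2) summable_on A" "(\<lambda>x. (g x)\<^sup>2) summable_on A"
  shows "(\<lambda>x. \<bar>f x * g x\<bar>) summable_on A"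
    and "(\<Sum>\<^sub>\<infinity>x\<in>A. \<bar>f x * g x\<bar>) \<le> sqrt (\<Sum>\<^sub>\<infinity>x\<in>A. (f x)\<^sup>2) * sqrt (\<Sum>\<^sub>\<infinity>x\<in>A. (g x)\<^sup>2)"
proof -
  show s: "(\<lambda>x. \<bar>f x * g x\<bar>) summable_on A"
    using sum_mult_le_sqrt_infsum[OF assms]
    by (intro nonneg_bdd_above_summable_on bdd_aboveI2) auto
  show "(\<Sum>\<^sub>\<infinity>x\<in>A. \<bar>f x * g x\<bar>) \<le> sqrt (\<Sum>\<^sub>\<infinity>x\<in>A. (f x)\<^sup>2) * sqrt (\<Sum>\<^sub>\<infinity>x\<in>A. (g x)\<^sup>2)"
    using sum_mult_le_sqrt_infsum[OF assms] by (rule infsum_le_finite_sums[OF s])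
qed

text \<open>Moving the adjoint across the inner product in each trace term reduces all later work to
  sums over \<open>some_onb\<close>.\<close>

lemma hs_inner_eq_infsum:
  assumes "S \<in> hs_class"
  shows "hs_inner T S = (\<Sum>\<^sub>\<infinity>e\<in>some_onb. cinner (T e) (S e))"
proof -
  have "cinner (cadjoint S (T e)) e = cinner (T e) (S e)" for e
    using assms cinner_cadjoint[of S e "T e"] cinner_commute
    unfolding hs_class_def by (metis (mono_tags, lifting) mem_Collect_eq)
  then show ?thesis
    by (simp add: hs_inner_def op_trace_def)
qed

lemma hs_norm_eq_sqrt_infsum:
  assumes "T \<in> hs_class"
  shows "hs_norm T = sqrt (\<Sum>\<^sub>\<infinity>e\<in>some_onb. (norm (T e))\<^sup>2)"
proof -
  have "(\<lambda>e. (norm (T e))\<^sup>2) summable_on some_onb"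
    using assms by (simp add: hs_class_def)
  then have "((\<lambda>e. complex_of_real ((norm (T e))\<^sup>2)) has_sum
      complex_of_real (\<Sum>\<^sub>\<infinity>e\<in>some_onb. (norm (T e))\<^sup>2)) some_onb"
    by (intro has_sum_of_real has_sum_infsum)
  then have "hs_inner T T = complex_of_real (\<Sum>\<^sub>\<infinity>e\<in>some_onb. (norm (T e))\<^sup>2)"
    by (simp add: hs_inner_eq_infsum[OF assms] cinner_self infsumI)
  then show ?thesis
    by (simp add: hs_norm_def)
qed

lemma hs_inner_self:
  assumes "T \<in> hs_class"
  shows "Re (hs_inner T T) = (hs_norm T)\<^sup>2"
proof -
  \<comment> \<open>Since \<open>sqrt\<close> is negative on negative reals, this also shows that
    the radicand is nonnegative, so squaring undoes the root.\<close>
  have "0 \<le> hs_norm T"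
    by (simp add: hs_norm_eq_sqrt_infsum[OF assms] infsum_nonneg)
  then show ?thesis
    by (simp add: hs_norm_def)
qed

text \<open>Cauchy-Schwarz twice: in the Hilbert space for each \<open>e\<close>, then for the
  square-summable families of norms.\<close>

lemma
  assumes "T \<in> hs_class" "S \<in> hs_class"
  shows abs_summable_hs_inner: "(\<lambda>e. norm (cinner (T e) (S e))) summable_on some_onb"
    and norm_hs_inner_le: "cmod (hs_inner T S) \<le> hs_norm T * hs_norm S"
proof -
  have sq: "(\<lambda>e. (norm (T e))\<^sup>2) summable_on some_onb" "(\<lambda>e. (norm (S e))\<^sup>2) summable_on some_onb"
    using assms by (auto simp: hs_class_def)
  note cs = cauchy_schwarz_infsum[OF sq]
  show abs: "(\<lambda>e. norm (cinner (T e) (S e))) summable_on some_onb"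
    using cs(1) by (rule Infinite_Sum.abs_summable_on_comparison_test') (simp add: norm_cinner_le)
  have "cmod (hs_inner T S) \<le> (\<Sum>\<^sub>\<infinity>e\<in>some_onb. cmod (cinner (T e) (S e)))"
    unfolding hs_inner_eq_infsum[OF assms(2)] by (rule norm_infsum_bound[OF abs])
  also have "\<dots> \<le> (\<Sum>\<^sub>\<infinity>e\<in>some_onb. \<bar>norm (T e) * norm (S e)\<bar>)"
    by (intro infsum_mono abs cs(1)) (simp add: norm_cinner_le)
  also have "\<dots> \<le> hs_norm T * hs_norm S"
    using cs(2) by (simp add: hs_norm_eq_sqrt_infsum assms)
  finally show "cmod (hs_inner T S) \<le> hs_norm T * hs_norm S" .
qed

text \<open>Riesz representation of the functional \<open>hs_inner (G f) T\<close> of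
  \<open>f\<close>, bounded by Cauchy-Schwarz for \<open>hs_inner\<close>.\<close>

lemma hs_inner_hs_adjoint:
  assumes G: "hs_bounded_clinear G" and T: "T \<in> hs_class"
  shows "hs_inner (G f) T = cinner f (hs_adjoint G T)"
proof -
  have Gf: "G f \<in> hs_class" for f
    using G by (simp add: hs_bounded_clinear_def)
  obtain B where B: "\<And>f. hs_norm (G f) \<le> B * norm f"
    using G by (auto simp: hs_bounded_clinear_def)
  have T0: "0 \<le> hs_norm T"
    by (simp add: hs_norm_eq_sqrt_infsum[OF T] infsum_nonneg)
  \<comment> \<open>Convergence is what allows \<open>infsum\<close> to be split in the additivity
    proof.\<close>
  have summ: "(\<lambda>e. cinner (G f e) (T e)) summable_on some_onb" for f
    by (rule abs_summable_summable[OF abs_summable_hs_inner[OF Gf T]])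
  have add: "hs_inner (G (f + g)) T = hs_inner (G f) T + hs_inner (G g) T" for f g
  proof -
    have "G (f + g) = (\<lambda>x. G f x + G g x)"
      using G by (simp add: hs_bounded_clinear_def)
    then show ?thesis
      by (simp add: hs_inner_eq_infsum[OF T] cinner_add_left infsum_add summ)
  qed
  have scale: "hs_inner (G (a *\<^sub>C f)) T = a * hs_inner (G f) T" for a f
  proof -
    have "G (a *\<^sub>C f) = (\<lambda>x. a *\<^sub>C G f x)"
      using G by (simp add: hs_bounded_clinear_def)
    then show ?thesis
      by (simp add: hs_inner_eq_infsum[OF T] cinner_scaleC_left infsum_cmult_right summ)
  qed
  have bound: "cmod (hs_inner (G f) T) \<le> (B * hs_norm T) * norm f" for f
    using norm_hs_inner_le[OF Gf[of f] T] mult_right_mono[OF B[of f] T0] by (simp add: mult_ac)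
  obtain z where z: "\<And>f. hs_inner (G f) T = cinner f z"
    using riesz_representation[of "\<lambda>f. hs_inner (G f) T", OF add scale bound] by blast
  then have "hs_adjoint G T = z"
    unfolding hs_adjoint_def by (intro the_equality) (auto intro: cinner_ext)
  with z show ?thesis
    by simp
qed


section \<open>The frame inequality\<close>

text \<open>Two finite sums over nested sets differ by a sum over the set difference, whose square
  norm is controlled by a tail of \<open>w\<close>. The net of finite sums is therefore Cauchy, and
  the bound passes to the limit.\<close>

lemma
  fixes v :: "'i \<Rightarrow> 'a::banach" and w :: "'i \<Rightarrow> real"
  assumes w: "w summable_on A"
    and le: "\<And>F. finite F \<Longrightarrow> F \<subseteq> A \<Longrightarrow> (norm (sum v F))\<^sup>2 \<le> sum w F"
  shows summable_on_if_sq_norm_sum_le: "v summable_on A"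
    and sq_norm_infsum_le: "(norm (infsum v A))\<^sup>2 \<le> infsum w A"
proof -
  \<comment> \<open>Singletons in \<open>le\<close> force \<open>w\<close> to be nonnegative, so
    partial sums stay below the full sum.\<close>
  have w0: "0 \<le> w x" if "x \<in> A" for x
    using le[of "{x}"] that order_trans[OF zero_le_power2] by force
  have "\<exists>P. eventually P (finite_subsets_at_top A) \<and>
      (\<forall>F F'. P F \<and> P F' \<longrightarrow> dist (sum v F) (sum v F') < d)" if "d > 0" for d
  proof -
    \<comment> \<open>The tolerance \<open>d\<^sup>2 / 8\<close> is strictly below
      \<open>(d / 2)\<^sup>2\<close>, so every larger finite set has its sum within
      \<open>d / 2\<close> of that over \<open>F0\<close>.\<close>
    obtain F0 where F0: "finite F0" "F0 \<subseteq> A" "dist (sum w F0) (infsum w A) \<le> d\<^sup>2 / 8"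
      using has_sum_finite_approximation[OF has_sum_infsum[OF w], of "d\<^sup>2 / 8"] \<open>d > 0\<close> by auto
    define P where "P F \<longleftrightarrow> finite F \<and> F0 \<subseteq> F \<and> F \<subseteq> A" for F
    have near: "dist (sum v F) (sum v F0) < d / 2" if "P F" for F
    proof -
      have F: "finite F" "F0 \<subseteq> F" "F \<subseteq> A"
        using that by (auto simp: P_def)
      have "(dist (sum v F) (sum v F0))\<^sup>2 = (norm (sum v (F - F0)))\<^sup>2"
        using F F0 by (simp add: sum_diff dist_norm)
      also have "\<dots> \<le> sum w F - sum w F0"
        using le[of "F - F0"] F F0 by (auto simp: sum_diff)
      also have "\<dots> \<le> infsum w A - sum w F0"
        using finite_sum_le_infsum[OF w F(1,3)] w0 by simp
      also have "\<dots> \<le> d\<^sup>2 / 8"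
        using F0(3) unfolding dist_real_def by linarith
      also have "\<dots> < (d / 2)\<^sup>2"
        using \<open>d > 0\<close> by (simp add: power_divide)
      finally show ?thesis
        by (rule power_less_imp_less_base) (use \<open>d > 0\<close> in simp)
    qed
    have "eventually P (finite_subsets_at_top A)"
      using F0 by (auto simp: eventually_finite_subsets_at_top P_def)
    moreover have "dist (sum v F) (sum v F') < d" if "P F" "P F'" for F F'
      using near[OF that(1)] near[OF that(2)] dist_triangle_half_l by blast
    ultimately show ?thesis
      by blast
  qed
  then have "cauchy_filter (filtermap (sum v) (finite_subsets_at_top A))"
    by (simp add: cauchy_filter_metric_filtermap)
  then obtain L where "(sum v \<longlongrightarrow> L) (finite_subsets_at_top A)"
    using cauchy_filter_complete_converges[of "filtermap (sum v) (finite_subsets_at_top A)" UNIV]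
    by (auto simp: complete_UNIV filterlim_def filtermap_bot_iff)
  then show v: "v summable_on A"
    by (auto simp: summable_on_def has_sum_def)
  show "(norm (infsum v A))\<^sup>2 \<le> infsum w A"
  proof (rule tendsto_le[OF finite_subsets_at_top_neq_bot])
    show "(sum w \<longlongrightarrow> infsum w A) (finite_subsets_at_top A)"
      using has_sum_infsum[OF w] by (simp add: has_sum_def)
    show "((\<lambda>F. (norm (sum v F))\<^sup>2) \<longlongrightarrow> (norm (infsum v A))\<^sup>2) (finite_subsets_at_top A)"
      using has_sum_infsum[OF v] unfolding has_sum_def by (intro tendsto_intros)
    show "\<forall>\<^sub>F F in finite_subsets_at_top A. (norm (sum v F))\<^sup>2 \<le> sum w F"
      using le by (auto intro: eventually_finite_subsets_at_top_weakI)
  qed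
qed

text \<open>With \<open>s = (\<Sum>j\<in>F. G\<^sub>j\<^sup>* G\<^sub>j f)\<close>, bound \<open>\<parallel>s\<parallel>\<^sup>2 = (\<Sum>j\<in>F. [G\<^sub>j s, G\<^sub>j f]\<^sub>\<tau>)\<close> by the Cauchy-Schwarz
  inequality and use the upper frame bound on \<open>s\<close>.\<close>

lemma sq_norm_sum_hs_adjoint_le:
  fixes G :: "'i \<Rightarrow> 'h::chilbert_space \<Rightarrow> 'k::chilbert_space \<Rightarrow> 'k"
  assumes pf: "parseval_hs_frame J G" and F: "finite F" "F \<subseteq> J"
  shows "(norm (\<Sum>j\<in>F. hs_adjoint (G j) (G j f)))\<^sup>2 \<le> (\<Sum>j\<in>F. (hs_norm (G j f))\<^sup>2)"
proof -
  define s where "s = (\<Sum>j\<in>F. hs_adjoint (G j) (G j f))"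
  have G: "hs_bounded_clinear (G j)" "G j h \<in> hs_class" if "j \<in> F" for j h
    using pf F that by (auto simp: parseval_hs_frame_def hs_frame_bounds_def hs_bounded_clinear_def)
  have summ: "(\<lambda>j. (hs_norm (G j s))\<^sup>2) summable_on J"
    and le: "(\<Sum>\<^sub>\<infinity>j\<in>J. (hs_norm (G j s))\<^sup>2) \<le> (norm s)\<^sup>2"
    using pf by (auto simp: parseval_hs_frame_def hs_frame_bounds_def)
  interpret bl: bounded_linear "\<lambda>y. Re (cinner s y)"
    by (rule bounded_linear_Re_cinner_right)
  have "(norm s)\<^sup>2 = Re (cinner s (\<Sum>j\<in>F. hs_adjoint (G j) (G j f)))"
    by (simp add: power2_norm_eq_cinner flip: s_def)
  also have "\<dots> = (\<Sum>j\<in>F. Re (hs_inner (G j s) (G j f)))"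
    unfolding bl.sum using G by (intro sum.cong) (simp_all add: hs_inner_hs_adjoint)
  also have "\<dots> \<le> (\<Sum>j\<in>F. \<bar>hs_norm (G j s)\<bar> * \<bar>hs_norm (G j f)\<bar>)"
  proof (rule sum_mono)
    fix j
    assume "j \<in> F"
    then have "Re (hs_inner (G j s) (G j f)) \<le> hs_norm (G j s) * hs_norm (G j f)"
      using norm_hs_inner_le[OF G(2) G(2)] complex_Re_le_cmod order_trans by blast
    then show "Re (hs_inner (G j s) (G j f)) \<le> \<bar>hs_norm (G j s)\<bar> * \<bar>hs_norm (G j f)\<bar>"
      using abs_ge_self[of "hs_norm (G j s) * hs_norm (G j f)"] by (simp add: abs_mult)
  qed
  also have "\<dots> \<le> L2_set (\<lambda>j. hs_norm (G j s)) F * L2_set (\<lambda>j. hs_norm (G j f)) F"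
    by (rule L2_set_mult_ineq)
  also have "\<dots> \<le> norm s * L2_set (\<lambda>j. hs_norm (G j f)) F"
  proof (rule mult_right_mono)
    have "(\<Sum>j\<in>F. (hs_norm (G j s))\<^sup>2) \<le> (norm s)\<^sup>2"
      using finite_sum_le_infsum[OF summ F] le by simp
    then show "L2_set (\<lambda>j. hs_norm (G j s)) F \<le> norm s"
      unfolding L2_set_def by (simp add: real_le_lsqrt)
  qed (rule L2_set_nonneg)
  finally have "norm s * norm s \<le> norm s * L2_set (\<lambda>j. hs_norm (G j f)) F"
    by (simp add: power2_eq_square)
  \<comment> \<open>The factor \<open>norm s\<close> cancels unless \<open>s = 0\<close>, where the
    claim is nonnegativity of \<open>L2_set\<close>.\<close>
  then have "norm s \<le> L2_set (\<lambda>j. hs_norm (G j f)) F"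
    by (cases "s = 0") (simp_all add: L2_set_nonneg)
  then have "(norm s)\<^sup>2 \<le> (L2_set (\<lambda>j. hs_norm (G j f)) F)\<^sup>2"
    by (simp add: power_mono)
  then show ?thesis
    by (simp add: s_def L2_set_def sum_nonneg)
qed

text \<open>The finite estimate passes to the limit. For the last equation, the continuous
  functional \<open>Re (cinner f _)\<close> acts termwise, and the adjoint turns each term into
  \<open>Re (hs_inner (G j f) (G j f))\<close>.\<close>

lemma
  fixes G :: "'i \<Rightarrow> 'h::chilbert_space \<Rightarrow> 'k::chilbert_space \<Rightarrow> 'k"
  assumes pf: "parseval_hs_frame J G" and K: "K \<subseteq> J"
  shows summable_on_hs_adjoint: "(\<lambda>j. hs_adjoint (G j) (G j f)) summable_on K"
    and sq_norm_infsum_hs_adjoint_le: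
      "(norm (\<Sum>\<^sub>\<infinity>j\<in>K. hs_adjoint (G j) (G j f)))\<^sup>2 \<le> (\<Sum>\<^sub>\<infinity>j\<in>K. (hs_norm (G j f))\<^sup>2)"
    and Re_cinner_infsum_hs_adjoint:
      "Re (cinner f (\<Sum>\<^sub>\<infinity>j\<in>K. hs_adjoint (G j) (G j f))) = (\<Sum>\<^sub>\<infinity>j\<in>K. (hs_norm (G j f))\<^sup>2)"
proof -
  have w: "(\<lambda>j. (hs_norm (G j f))\<^sup>2) summable_on K"
    using pf K summable_on_subset_banach
    unfolding parseval_hs_frame_def hs_frame_bounds_def by blast
  have le: "(norm (\<Sum>j\<in>F. hs_adjoint (G j) (G j f)))\<^sup>2 \<le> (\<Sum>j\<in>F. (hs_norm (G j f))\<^sup>2)"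
    if "finite F" "F \<subseteq> K" for F
    using sq_norm_sum_hs_adjoint_le[OF pf that(1)] that(2) K by blast
  show v: "(\<lambda>j. hs_adjoint (G j) (G j f)) summable_on K"
    by (rule summable_on_if_sq_norm_sum_le[OF w le])
  show "(norm (\<Sum>\<^sub>\<infinity>j\<in>K. hs_adjoint (G j) (G j f)))\<^sup>2 \<le> (\<Sum>\<^sub>\<infinity>j\<in>K. (hs_norm (G j f))\<^sup>2)"
    by (rule sq_norm_infsum_le[OF w le])
  have "Re (cinner f (hs_adjoint (G j) (G j f))) = (hs_norm (G j f))\<^sup>2" if "j \<in> K" for j
  proof -
    have "hs_bounded_clinear (G j)" "G j f \<in> hs_class"
      using pf K that
      by (auto simp: parseval_hs_frame_def hs_frame_bounds_def hs_bounded_clinear_def)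
    then show ?thesis
      by (simp flip: hs_inner_hs_adjoint add: hs_inner_self)
  qed
  then show "Re (cinner f (\<Sum>\<^sub>\<infinity>j\<in>K. hs_adjoint (G j) (G j f))) = (\<Sum>\<^sub>\<infinity>j\<in>K. (hs_norm (G j f))\<^sup>2)"
    using infsumI[OF has_sum_bounded_linear[OF bounded_linear_Re_cinner_right has_sum_infsum[OF v], of f]]
    by (simp cong: infsum_cong)
qed

lemma parseval_reconstruction:
  fixes G :: "'i \<Rightarrow> 'h::chilbert_space \<Rightarrow> 'k::chilbert_space \<Rightarrow> 'k"
  assumes pf: "parseval_hs_frame J G"
  shows "(\<Sum>\<^sub>\<infinity>j\<in>J. hs_adjoint (G j) (G j f)) = f"
proof -
  define s where "s = (\<Sum>\<^sub>\<infinity>j\<in>J. hs_adjoint (G j) (G j f))"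
  have eq: "(\<Sum>\<^sub>\<infinity>j\<in>J. (hs_norm (G j f))\<^sup>2) = (norm f)\<^sup>2"
    using pf by (auto simp: parseval_hs_frame_def hs_frame_bounds_def intro: antisym)
  \<comment> \<open>Expanding the square, the cross term is \<open>- 2 * (norm f)\<^sup>2\<close>
    and the other two terms are each at most \<open>(norm f)\<^sup>2\<close>.\<close>
  have "(norm (f - s))\<^sup>2 \<le> 0"
    using sq_norm_infsum_hs_adjoint_le[OF pf order_refl, of f]
      Re_cinner_infsum_hs_adjoint[OF pf order_refl, of f]
    by (simp add: power2_norm_diff eq flip: s_def)
  then show ?thesis
    by (simp add: s_def)
qed

theorem corollary3p3:
  fixes G :: "'i \<Rightarrow> 'h::chilbert_space \<Rightarrow> 'k::chilbert_space \<Rightarrow> 'k"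
    and J :: "'i set"
  assumes "countable J"
    and "parseval_hs_frame J G"
  shows "\<forall>K f. K \<subseteq> J \<longrightarrow>
    (\<lambda>j. hs_adjoint (G j) (G j f)) summable_on (J - K) \<and>
    (\<Sum>\<^sub>\<infinity>j\<in>K. (hs_norm (G j f))\<^sup>2) + (norm (\<Sum>\<^sub>\<infinity>j\<in>J - K. hs_adjoint (G j) (G j f)))\<^sup>2
      \<ge> 3 / 4 * (norm f)\<^sup>2"
proof (intro allI impI conjI)
  fix K f
  assume K: "K \<subseteq> J"
  note pf = assms(2)
  define a where "a = (\<Sum>\<^sub>\<infinity>j\<in>K. hs_adjoint (G j) (G j f))"
  define b where "b = (\<Sum>\<^sub>\<infinity>j\<in>J - K. hs_adjoint (G j) (G j f))"
  show v: "(\<lambda>j. hs_adjoint (G j) (G j f)) summable_on (J - K)"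
    by (rule summable_on_hs_adjoint[OF pf Diff_subset])
  have "a + b = (\<Sum>\<^sub>\<infinity>j\<in>K \<union> (J - K). hs_adjoint (G j) (G j f))"
    unfolding a_def b_def
    by (rule infsum_Un_disjoint[symmetric, OF summable_on_hs_adjoint[OF pf K] v]) auto
  also have "K \<union> (J - K) = J"
    using K by blast
  finally have "a = f - b"
    using parseval_reconstruction[OF pf, of f] by (simp add: eq_diff_eq)
  then have "(\<Sum>\<^sub>\<infinity>j\<in>K. (hs_norm (G j f))\<^sup>2) = (norm f)\<^sup>2 - Re (cinner f b)"
    using Re_cinner_infsum_hs_adjoint[OF pf K, of f]
    by (simp add: cinner_diff_right power2_norm_eq_cinner flip: a_def)
  \<comment> \<open>Expanding the square norm of \<open>f / 2 - b\<close> produces the quarter of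
    \<open>(norm f)\<^sup>2\<close> that separates 1 from 3/4.\<close>
  moreover have "0 \<le> (norm f)\<^sup>2 / 4 - Re (cinner f b) + (norm b)\<^sup>2"
    using zero_le_power2[of "norm ((1/2) *\<^sub>R f - b)"] unfolding power2_norm_diff
    by (simp add: cinner_scaleR_left power_divide)
  ultimately show "3 / 4 * (norm f)\<^sup>2 \<le> (\<Sum>\<^sub>\<infinity>j\<in>K. (hs_norm (G j f))\<^sup>2) +
      (norm (\<Sum>\<^sub>\<infinity>j\<in>J - K. hs_adjoint (G j) (G j f)))\<^sup>2"
    by (simp flip: b_def)
qed

end
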